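(* Let $F$ be a field, let $R\colon F[x]\to F[x]$ be a Rota--Baxter operator of weight $1$, and put $R'=-R-\mathrm{id}$. If both $R$ and $R'$ are injective, then $\operatorname{char} F=0$.
   Context: A Rota--Baxter operator of weight $1$ on $F[x]$ is an $F$-linear map $R\colon F[x]\to F[x]$ such that $R(f)R(g)=R\big(R(f)g+fR(g)\big)+R(fg)$ for all $f,g\in F[x]$. *)

theory Defs
  imports "HOL-Computational_Algebra.Computational_Algebra"
begin

definition rota_baxter_one :: "('a::field poly \<Rightarrow> 'a poly) \<Rightarrow> bool" where
  "rota_baxter_one R \<longleftrightarrow>
     Vector_Spaces.linear smult smult R \<and>
     (\<forall>f g. R f * R g = R (R f * g + f * R g) + R (f * g))"

end

theory Submission
  imports Defs
begin

text \<open>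
  The idea is to transport powers through \<open>R\<close>. The Rota--Baxter identity says that \<open>R\<close> turns the
  product \<open>f \<circ> g = R f * g + f * R g + f * g\<close> into the usual one, and \<open>f \<mapsto> R f + f\<close> does so as
  well. Subtracting these two multiplicative maps shows that for \<open>n \<ge> 1\<close> the \<open>n\<close>-th \<open>\<circ>\<close>-power of \<open>f\<close> is
  \<open>(R f + f) ^ n - R f ^ n\<close>, which \<open>R\<close> therefore sends to \<open>R f ^ n\<close> (lemma
  \<open>rota_baxter_one_power\<close>).

  Suppose now that the characteristic is a prime \<open>p\<close>. For \<open>f = 1\<close> and \<open>n = p\<close> the Frobenius
  identity collapses the \<open>\<circ>\<close>-power to \<open>(R 1 + 1) ^ p - R 1 ^ p = 1\<close>, hence \<open>R 1 = R 1 ^ p\<close>.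
  Comparing degrees, \<open>R 1\<close> is a constant. The identity at \<open>f = g = 1\<close> then reads
  \<open>R 1 * (R 1 + 1) = 0\<close>, so that \<open>1\<close> lies in the kernel of \<open>R\<close> or in that of \<open>- R - id\<close>.
\<close>

lemma rota_baxter_one_power:
  assumes "rota_baxter_one R"
  shows "R ((R f + f) ^ Suc n - R f ^ Suc n) = R f ^ Suc n"
proof (induction n)
  case 0
  show ?case by simp
next
  case (Suc n)
  interpret R: Vector_Spaces.linear smult smult R
    using assms by (simp add: rota_baxter_one_def)
  define g where "g = (R f + f) ^ Suc n - R f ^ Suc n"
  have "(R f + f) ^ Suc (Suc n) - R f ^ Suc (Suc n) = R f * g + f * R g + f * g"
    unfolding Suc.IH[folded g_def] by (simp add: g_def algebra_simps)
  moreover have "R (R f * g + f * R g + f * g) = R f * R g"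
    using assms by (simp add: rota_baxter_one_def R.add)
  ultimately show ?case
    using Suc.IH[folded g_def] by simp
qed

text \<open>
  The Rota--Baxter identity at \<open>f = g = 1\<close> gives \<open>R 1 * R 1 = R (2 * R 1 + 1)\<close>, and linearity
  evaluates the right-hand side once \<open>R 1\<close> is a scalar.
\<close>

lemma rota_baxter_one_constant_image_of_one:
  assumes RB: "rota_baxter_one R" and const: "degree (R 1) = 0"
  shows "R 1 = 0 \<or> R 1 = - 1"
proof -
  interpret R: Vector_Spaces.linear smult smult R
    using RB by (simp add: rota_baxter_one_def)
  obtain c where c: "R 1 = [:c:]"
    using const by (rule degree_eq_zeroE)
  have R_scalar: "R [:a:] = [:a * c:]" for a
    using R.scale[of a 1] by (simp add: c)
  have "R 1 * R 1 = R (R 1 * 1 + 1 * R 1) + R (1 * 1)"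
    using RB unfolding rota_baxter_one_def by blast
  hence "[:c * c:] = [:(c + c) * c + c:]"
    by (simp add: c R_scalar)
  hence "c * (c + 1) = 0"
    by (simp add: algebra_simps)
  hence "c = 0 \<or> c = - 1"
    by (simp add: eq_neg_iff_add_eq_0)
  thus ?thesis
    unfolding c by (auto simp: one_pCons)
qed

theorem lemma4p3:
  fixes R R' :: "'a::field poly \<Rightarrow> 'a poly"
  assumes "rota_baxter_one R"
    and "R' = (\<lambda>f. - R f - f)"
    and "inj R" and "inj R'"
  shows "CHAR('a) = 0"
proof (rule ccontr)
  assume "CHAR('a) \<noteq> 0"
  hence "CHAR('a poly) > 0"
    by simp
  hence p: "prime CHAR('a poly)"
    by (rule prime_CHAR_semidom)
  obtain n where n: "CHAR('a poly) = Suc n"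
    using \<open>CHAR('a poly) > 0\<close> gr0_conv_Suc by blast
  interpret R: Vector_Spaces.linear smult smult R
    using assms(1) by (simp add: rota_baxter_one_def)
  have "(R 1 + 1) ^ Suc n - R 1 ^ Suc n = 1"
    using freshmans_dream[OF p refl, of "R 1" 1] unfolding n
    by (simp only: power_one add_diff_cancel_left')
  hence fixed: "R 1 ^ Suc n = R 1"
    using rota_baxter_one_power[OF assms(1), of 1 n] by (simp only:)
  have nonzero: "R 1 \<noteq> 0"
    using assms(3) R.zero by (metis injD zero_neq_one)
  have "degree (R 1) = Suc n * degree (R 1)"
    using degree_power_eq[OF nonzero, of "Suc n"] by (simp only: fixed)
  moreover have "Suc n > 1"
    using prime_gt_1_nat[OF p] by (simp only: n)
  ultimately have "degree (R 1) = 0"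
    by simp
  hence "R 1 = - 1"
    using rota_baxter_one_constant_image_of_one[OF assms(1)] nonzero by blast
  hence "R' 1 = R' 0"
    by (simp add: assms(2) R.zero)
  thus False
    using assms(4) by (metis injD zero_neq_one)
qed

end
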